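(* Let $\gamma\in(0,1]$, $\kappa\in[0,1)$ and $b>0$. For $a>0$ let $X$ be a $\mathrm{PDS}(\gamma,\lambda,\kappa)$ random variable with $\lambda=b/a^{\gamma}$, let $X^a=aX$, and let $f^a$ be the characteristic function of $X^a$, that is, $$f^a(t)=\exp\left\{-\lambda\left(\frac{1-e^{\mathrm{i}at}}{1-\kappa e^{\mathrm{i}at}}\right)^{\gamma}\right\}.$$ Then for every $t\in\mathbb{R}$ $$f^a(t)\longrightarrow\varphi(t)=\exp\left\{-\sigma|t|^{\gamma}\left(1-\mathrm{i}\,\mathrm{sign}(t)\tan\left(\frac{\pi\gamma}{2}\right)\right)\right\}\qquad\text{as }a\to0,$$ where $\sigma=\frac{b}{(1-\kappa)^{\gamma}}\cos\left(\frac{\pi\gamma}{2}\right)$.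
   Context: For $\gamma\in(0,1]$, $\lambda>0$, $\kappa\in[0,1)$, $\mathrm{PDS}(\gamma,\lambda,\kappa)$ denotes the distribution on $\mathbb{N}_0$ with probability generating function $\mathrm{E}z^X=\exp\left\{-\lambda\left(\frac{1-z}{1-\kappa z}\right)^{\gamma}\right\}$. Complex powers are principal values. The limit is over $a\downarrow0$. The product $\cos(\pi\gamma/2)\left(1-\mathrm{i}\,\mathrm{sign}(t)\tan(\pi\gamma/2)\right)$ is read as $\cos(\pi\gamma/2)-\mathrm{i}\,\mathrm{sign}(t)\sin(\pi\gamma/2)$, which also covers $\gamma=1$. *)

theory Defs
  imports "HOL-Probability.Probability"
begin

definition pgf :: "nat measure \<Rightarrow> complex \<Rightarrow> complex" where
  "pgf N z = (CLINT n|N. z ^ n)"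

text \<open>
  On the closed unit disc \<open>(1 - z) / (1 - \<kappa> z)\<close> has nonnegative real part, so the principal
  branch computed by \<^const>\<open>powr\<close> is continuous there; at \<open>z = 1\<close> it gives \<open>0 powr \<gamma> = 0\<close>.
\<close>

definition is_PDS :: "real \<Rightarrow> real \<Rightarrow> real \<Rightarrow> nat measure \<Rightarrow> bool" where
  "is_PDS \<gamma> l \<kappa> N \<longleftrightarrow>
     prob_space N \<and> sets N = UNIV \<and>
     (\<forall>z. norm z \<le> 1 \<longrightarrow>
        pgf N z = exp (- of_real l * ((1 - z) / (1 - of_real \<kappa> * z)) powr of_real \<gamma>))"

text \<open>
  The strictly stable characteristic function
  \<open>exp (- \<sigma> |t|\<^sup>\<gamma> (1 - \<i> sgn t tan (\<pi> \<gamma> / 2)))\<close> with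
  \<open>\<sigma> = b / (1 - \<kappa>)\<^sup>\<gamma> cos (\<pi> \<gamma> / 2)\<close>. The factor \<open>cos (\<pi> \<gamma> / 2)\<close> of \<open>\<sigma>\<close> is multiplied
  out, so that \<open>\<gamma> = 1\<close>, where \<open>\<sigma> = 0\<close> and the tangent has a pole, is covered: there the value
  is \<open>exp (\<i> t b / (1 - \<kappa>))\<close>. For \<open>\<gamma> < 1\<close> see \<open>limit_cf_tan\<close> below.
\<close>

definition limit_cf :: "real \<Rightarrow> real \<Rightarrow> real \<Rightarrow> real \<Rightarrow> complex" where
  "limit_cf \<gamma> \<kappa> b t =
     exp (- of_real (b / (1 - \<kappa>) powr \<gamma> * \<bar>t\<bar> powr \<gamma>) *
            (of_real (cos (pi * \<gamma> / 2)) - \<i> * of_real (sgn t * sin (pi * \<gamma> / 2))))"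

lemma limit_cf_tan:
  assumes "0 < \<gamma>" "\<gamma> < 1"
  defines "\<sigma> \<equiv> \<lambda>\<kappa> b. b / (1 - \<kappa>) powr \<gamma> * cos (pi * \<gamma> / 2)"
  shows "limit_cf \<gamma> \<kappa> b t =
    exp (- of_real (\<sigma> \<kappa> b * \<bar>t\<bar> powr \<gamma>) * (1 - \<i> * of_real (sgn t * tan (pi * \<gamma> / 2))))"
proof -
  have "cos (pi * \<gamma> / 2) \<noteq> 0"
    using assms(1,2) cos_gt_zero[of "pi * \<gamma> / 2"] by auto
  then have "complex_of_real (sgn t * sin (pi * \<gamma> / 2)) =
      of_real (cos (pi * \<gamma> / 2)) * of_real (sgn t * tan (pi * \<gamma> / 2))"
    unfolding of_real_mult[symmetric] by (simp add: tan_def)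
  then have "of_real (cos (pi * \<gamma> / 2)) - \<i> * of_real (sgn t * sin (pi * \<gamma> / 2)) =
      of_real (cos (pi * \<gamma> / 2)) * (1 - \<i> * of_real (sgn t * tan (pi * \<gamma> / 2)))"
    by (simp only: right_diff_distrib mult_1_right mult.left_commute)
  then show ?thesis
    unfolding limit_cf_def \<sigma>_def by (simp only:) (simp add: mult_ac)
qed


subsection \<open>The distributions exist\<close>

lemma integrable_pgf: "norm z \<le> 1 \<Longrightarrow> integrable (measure_pmf p) (\<lambda>n. z ^ n :: complex)"
  by (intro measure_pmf.integrable_const_bound[where B=1])
     (auto simp: norm_power power_le_one)

lemma norm_pgf_le:
  assumes "norm z \<le> 1"
  shows "norm (pgf (measure_pmf p) z) \<le> 1"
proof -
  have "norm (pgf (measure_pmf p) z) \<le> (LINT n|measure_pmf p. norm (z ^ n))"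
    unfolding pgf_def by (rule integral_norm_bound)
  also have "\<dots> \<le> (LINT n|measure_pmf p. 1)"
    using assms
    by (intro integral_mono integrable_norm integrable_pgf) (auto simp: norm_power power_le_one)
  finally show ?thesis by simp
qed

lemma pgf_sums:
  assumes "norm z \<le> 1"
  shows "(\<lambda>n. of_real (pmf p n) * z ^ n) sums pgf (measure_pmf p) z"
proof -
  have "integrable (count_space UNIV) (\<lambda>n. pmf p n *\<^sub>R z ^ n)"
    using integrable_pgf[OF assms, of p]
    unfolding measure_pmf_eq_density by (subst (asm) integrable_density) auto
  moreover have "pgf (measure_pmf p) z = (\<integral>n. pmf p n *\<^sub>R z ^ n \<partial>count_space UNIV)"
    unfolding pgf_def measure_pmf_eq_density by (subst integral_density) auto
  ultimately show ?thesis
    using sums_integral_count_space_nat[of "\<lambda>n. pmf p n *\<^sub>R z ^ n"]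
    by (simp add: scaleR_conv_of_real)
qed

lemma pgf_eqI:
  assumes "norm z \<le> 1" "(\<lambda>n. of_real (pmf p n) * z ^ n) sums s"
  shows "pgf (measure_pmf p) z = s"
  using pgf_sums[OF assms(1)] assms(2) by (rule sums_unique2)

lemma expectation_bind_pmf:
  fixes h :: "'b \<Rightarrow> real"
  assumes "\<And>x. \<bar>h x\<bar> \<le> 1"
  shows "measure_pmf.expectation (bind_pmf p f) h =
    measure_pmf.expectation p (\<lambda>x. measure_pmf.expectation (f x) h)"
  unfolding measure_pmf_bind using assms
  by (intro integral_bind[where K="count_space UNIV" and B=1 and B'=1])
     (auto simp: space_subprob_algebra subprob_space_measure_pmf
       measure_pmf.finite_measure_axioms)

lemma pgf_bind:
  assumes "norm z \<le> 1"
  shows "pgf (measure_pmf (bind_pmf p f)) z = (CLINT x|measure_pmf p. pgf (measure_pmf (f x)) z)"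
proof (rule complex_eqI)
  note int = integrable_pgf[OF assms]
  have int': "integrable (measure_pmf p) (\<lambda>x. pgf (measure_pmf (f x)) z)"
    by (intro measure_pmf.integrable_const_bound[where B=1]) (auto simp: norm_pgf_le assms)
  have b: "norm (z ^ n) \<le> 1" for n
    using assms by (simp add: norm_power power_le_one)
  have re: "\<bar>Re (z ^ n)\<bar> \<le> 1" and im: "\<bar>Im (z ^ n)\<bar> \<le> 1" for n
    using b[of n] abs_Re_le_cmod[of "z ^ n"] abs_Im_le_cmod[of "z ^ n"] by linarith+
  show "Re (pgf (measure_pmf (bind_pmf p f)) z) =
      Re (CLINT x|measure_pmf p. pgf (measure_pmf (f x)) z)"
    unfolding integral_Re[OF int', symmetric] unfolding pgf_def integral_Re[OF int, symmetric]
    by (rule expectation_bind_pmf[OF re])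
  show "Im (pgf (measure_pmf (bind_pmf p f)) z) =
      Im (CLINT x|measure_pmf p. pgf (measure_pmf (f x)) z)"
    unfolding integral_Im[OF int', symmetric] unfolding pgf_def integral_Im[OF int, symmetric]
    by (rule expectation_bind_pmf[OF im])
qed

lemma pgf_map_plus:
  "pgf (measure_pmf (map_pmf ((+) k) p)) z = z ^ k * pgf (measure_pmf p) z"
  by (simp add: pgf_def power_add)

primrec iid_sum :: "nat pmf \<Rightarrow> nat \<Rightarrow> nat pmf" where
  "iid_sum p 0 = return_pmf 0"
| "iid_sum p (Suc n) = bind_pmf p (\<lambda>k. map_pmf ((+) k) (iid_sum p n))"

lemma pgf_iid_sum:
  assumes "norm z \<le> 1"
  shows "pgf (measure_pmf (iid_sum p n)) z = pgf (measure_pmf p) z ^ n"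
proof (induction n)
  case 0
  then show ?case by (simp add: pgf_def integral_return)
next
  case (Suc n)
  then show ?case using assms by (simp add: pgf_bind pgf_map_plus) (simp add: pgf_def)
qed

lemma pgf_compound:
  assumes "norm z \<le> 1"
  shows "pgf (measure_pmf (bind_pmf q (iid_sum p))) z = pgf (measure_pmf q) (pgf (measure_pmf p) z)"
  using assms by (simp add: pgf_bind pgf_iid_sum) (simp add: pgf_def)

lemma pgf_poisson:
  assumes "norm z \<le> 1" "l > 0"
  shows "pgf (measure_pmf (poisson_pmf l)) z = exp (- of_real l * (1 - z))"
proof (rule pgf_eqI)
  have "(\<lambda>n. of_real (exp (-l)) * ((of_real l * z) ^ n /\<^sub>R fact n)) sums
      (of_real (exp (-l)) * exp (of_real l * z))"
    by (intro sums_mult exp_converges)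
  moreover have "of_real (exp (-l)) * exp (of_real l * z) = exp (- of_real l * (1 - z))"
    by (simp add: exp_of_real[symmetric] mult_exp_exp algebra_simps)
  moreover have "of_real (exp (-l)) * ((of_real l * z) ^ n /\<^sub>R fact n) =
      of_real (pmf (poisson_pmf l) n) * z ^ n" for n
    using assms by (simp add: scaleR_conv_of_real power_mult_distrib field_simps)
  ultimately show "(\<lambda>n. of_real (pmf (poisson_pmf l) n) * z ^ n) sums
      exp (- of_real l * (1 - z))" by simp
qed (use assms in simp)

lemma one_minus_of_real_mult_neq_0:
  assumes "norm (z::complex) \<le> 1" "0 \<le> \<kappa>" "\<kappa> < 1"
  shows "1 - of_real \<kappa> * z \<noteq> 0"
proof
  assume "1 - of_real \<kappa> * z = 0"
  then have "norm (of_real \<kappa> * z) = 1" by (simp add: eq_diff_eq)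
  moreover have "norm (of_real \<kappa> * z) \<le> \<kappa> * 1"
    unfolding norm_mult using assms by (intro mult_mono) auto
  ultimately show False using assms by simp
qed

lemma pgf_geometric:
  assumes "norm z \<le> 1" "0 \<le> \<kappa>" "\<kappa> < 1"
  shows "pgf (measure_pmf (map_pmf ((+) 1) (geometric_pmf (1 - \<kappa>)))) z =
           1 - (1 - z) / (1 - of_real \<kappa> * z)"
proof -
  have "norm (of_real \<kappa> * z) \<le> \<kappa> * 1"
    unfolding norm_mult using assms by (intro mult_mono) auto
  then have "norm (of_real \<kappa> * z) < 1" using assms by simp
  then have "(\<lambda>n. of_real (1 - \<kappa>) * (of_real \<kappa> * z) ^ n) sums
      (of_real (1 - \<kappa>) * (1 / (1 - of_real \<kappa> * z)))"
    by (intro sums_mult geometric_sums)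
  moreover have "of_real (1 - \<kappa>) * (of_real \<kappa> * z) ^ n =
      of_real (pmf (geometric_pmf (1 - \<kappa>)) n) * z ^ n" for n
    using assms by (simp add: power_mult_distrib)
  ultimately have "pgf (measure_pmf (geometric_pmf (1 - \<kappa>))) z =
      of_real (1 - \<kappa>) * (1 / (1 - of_real \<kappa> * z))"
    using assms(1) by (intro pgf_eqI) simp_all
  then show ?thesis
    using one_minus_of_real_mult_neq_0[OF assms]
    unfolding pgf_map_plus by (simp only:) (simp add: divide_simps, simp add: algebra_simps)
qed

definition sibuya :: "real \<Rightarrow> nat \<Rightarrow> real" where
  "sibuya \<gamma> n = (if n = 0 then 0 else - ((-1) ^ n * (\<gamma> gchoose n)))"

lemma sibuya_nonneg:
  assumes "0 < \<gamma>" "\<gamma> \<le> 1"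
  shows "sibuya \<gamma> n \<ge> 0"
proof (cases n)
  case (Suc k)
  have "sibuya \<gamma> n = \<gamma> * pochhammer (1 - \<gamma>) k / fact (Suc k)"
    unfolding Suc sibuya_def gbinomial_pochhammer pochhammer_rec
    by (simp add: add.commute flip: mult.assoc power_add power_mult_distrib)
  moreover have "pochhammer (1 - \<gamma>) k \<ge> 0"
    unfolding pochhammer_prod using assms by (intro prod_nonneg) auto
  ultimately show ?thesis using assms by simp
qed (simp add: sibuya_def)

lemma sibuya_sums_complex:
  assumes "norm (z::complex) < 1"
  shows "(\<lambda>n. of_real (sibuya \<gamma> n) * z ^ n) sums (1 - (1 - z) powr of_real \<gamma>)"
proof -
  have "(\<lambda>n. (if n = 0 then 1 else 0) - (of_real \<gamma> gchoose n) * (- z) ^ n) sums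
      (1 - (1 + - z) powr of_real \<gamma>)"
    using assms by (intro sums_diff gen_binomial_complex) (use sums_single[of 0 "\<lambda>_. 1"] in auto)
  moreover have "(if n = 0 then 1 else 0) - (of_real \<gamma> gchoose n) * (- z) ^ n =
      of_real (sibuya \<gamma> n) * z ^ n" for n
    by (auto simp: sibuya_def power_minus[of z] gbinomial_prod_rev)
  ultimately show ?thesis by simp
qed

lemma sibuya_sums_real:
  assumes "\<bar>x\<bar> < 1"
  shows "(\<lambda>n. sibuya \<gamma> n * x ^ n) sums (1 - (1 - x) powr \<gamma>)"
proof -
  have "(\<lambda>n. (if n = 0 then 1 else 0) - (\<gamma> gchoose n) * (- x) ^ n) sums
      (1 - (1 + - x) powr \<gamma>)"
    using assms by (intro sums_diff gen_binomial_real) (use sums_single[of 0 "\<lambda>_. 1"] in auto)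
  moreover have "(if n = 0 then 1 else 0) - (\<gamma> gchoose n) * (- x) ^ n =
      sibuya \<gamma> n * x ^ n" for n
    by (auto simp: sibuya_def power_minus[of x])
  ultimately show ?thesis by simp
qed

lemma sibuya_sums_1:
  assumes "0 < \<gamma>" "\<gamma> \<le> 1"
  shows "sibuya \<gamma> sums 1"
proof -
  note nn = sibuya_nonneg[OF assms]
  have ev: "eventually (\<lambda>x. x \<in> {0<..<1}) (at_left (1::real))"
    by (intro eventually_at_leftI[of 0]) auto
  have le: "sum (sibuya \<gamma>) {..<n} \<le> 1" for n
  proof (rule tendsto_upperbound)
    show "((\<lambda>x. \<Sum>i<n. sibuya \<gamma> i * x ^ i) \<longlongrightarrow> sum (sibuya \<gamma>) {..<n}) (at_left 1)"
      by (rule tendsto_eq_intros refl)+ simp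
    show "eventually (\<lambda>x. (\<Sum>i<n. sibuya \<gamma> i * x ^ i) \<le> 1) (at_left 1)"
      using ev
    proof eventually_elim
      case (elim x)
      then have s: "(\<lambda>n. sibuya \<gamma> n * x ^ n) sums (1 - (1 - x) powr \<gamma>)"
        by (intro sibuya_sums_real) auto
      have "(\<Sum>i<n. sibuya \<gamma> i * x ^ i) \<le> (\<Sum>i. sibuya \<gamma> i * x ^ i)"
        using s elim nn by (intro sum_le_suminf) (auto simp: sums_iff)
      also have "\<dots> \<le> 1" using s by (simp add: sums_iff)
      finally show ?case .
    qed
  qed simp
  have summ: "summable (sibuya \<gamma>)"
    using nn le by (intro bounded_imp_summable[where B=1]) (auto simp: lessThan_Suc_atMost[symmetric] simp del: sum.lessThan_Suc)
  have "suminf (sibuya \<gamma>) \<le> 1"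
    using summ le by (intro suminf_le_const) auto
  moreover have "1 \<le> suminf (sibuya \<gamma>)"
  proof (rule tendsto_upperbound)
    show "((\<lambda>x. 1 - (1 - x) powr \<gamma>) \<longlongrightarrow> 1) (at_left 1)"
    proof -
      have "((\<lambda>x. 1 - (1 - x) powr \<gamma>) \<longlongrightarrow> 1 - (1 - 1) powr \<gamma>) (at_left 1)"
        using assms ev by (intro tendsto_intros tendsto_powr2) (auto elim: eventually_mono)
      then show ?thesis by simp
    qed
    show "eventually (\<lambda>x. 1 - (1 - x) powr \<gamma> \<le> suminf (sibuya \<gamma>)) (at_left 1)"
      using ev
    proof eventually_elim
      case (elim x)
      then have s: "(\<lambda>n. sibuya \<gamma> n * x ^ n) sums (1 - (1 - x) powr \<gamma>)"
        by (intro sibuya_sums_real) auto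
      have "sibuya \<gamma> n * x ^ n \<le> sibuya \<gamma> n * 1" for n
        using elim nn by (intro mult_left_mono power_le_one) auto
      then have "(\<Sum>i. sibuya \<gamma> i * x ^ i) \<le> suminf (sibuya \<gamma>)"
        using s summ by (intro suminf_le) (auto simp: sums_iff)
      then show ?case using s by (simp add: sums_iff)
    qed
  qed simp
  ultimately show ?thesis using summ by (simp add: sums_iff)
qed

lemma pmf_sibuya:
  assumes "0 < \<gamma>" "\<gamma> \<le> 1"
  shows "pmf (embed_pmf (sibuya \<gamma>)) n = sibuya \<gamma> n"
proof (rule pmf_embed_pmf)
  have "(\<Sum>n. ennreal (sibuya \<gamma> n)) = ennreal 1"
    using assms by (intro suminf_ennreal_eq sibuya_nonneg sibuya_sums_1)
  then show "(\<integral>\<^sup>+n. ennreal (sibuya \<gamma> n) \<partial>count_space UNIV) = 1"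
    by (simp add: nn_integral_count_space_nat)
qed (use assms sibuya_nonneg in auto)

lemma pgf_sibuya:
  assumes "0 < \<gamma>" "\<gamma> \<le> 1" "norm z \<le> 1"
  shows "pgf (measure_pmf (embed_pmf (sibuya \<gamma>))) z = 1 - (1 - z) powr of_real \<gamma>"
proof (rule LIMSEQ_unique)
  define p where "p = embed_pmf (sibuya \<gamma>)"
  define r :: "nat \<Rightarrow> complex" where "r k = of_real (real k / real (Suc k))" for k
  have r_lim: "r \<longlonglongrightarrow> 1"
    unfolding r_def using tendsto_of_real[OF LIMSEQ_n_over_Suc_n, where 'a=complex] by simp
  have r_norm: "norm (r k) < 1" for k
    unfolding r_def norm_of_real by simp
  have rz: "norm (r k * z) < 1" for k
    using mult_mono[OF order_refl assms(3), of "norm (r k)"] r_norm[of k]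
    by (simp add: norm_mult)
  show "(\<lambda>k. pgf (measure_pmf p) (r k * z)) \<longlonglongrightarrow> pgf (measure_pmf p) z"
    unfolding pgf_def
  proof (rule integral_dominated_convergence[where w="\<lambda>_. 1"])
    show "AE n in measure_pmf p. (\<lambda>k. (r k * z) ^ n) \<longlonglongrightarrow> z ^ n"
      using tendsto_power[OF tendsto_mult[OF r_lim tendsto_const[of z]]] by simp
    show "AE n in measure_pmf p. norm ((r k * z) ^ n) \<le> 1" for k
      using power_le_one[OF norm_ge_zero less_imp_le[OF rz[of k]]] by (simp add: norm_power)
  qed auto
  have lim: "(\<lambda>k. 1 - r k * z) \<longlonglongrightarrow> 1 - z"
    using tendsto_diff[OF tendsto_const tendsto_mult[OF r_lim tendsto_const[of z]], of 1] by simp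
  have "(\<lambda>k. (1 - r k * z) powr of_real \<gamma>) \<longlonglongrightarrow> (1 - z) powr of_real \<gamma>"
  proof (cases "z = 1")
    case True
    with lim assms(1) show ?thesis
      by (auto intro!: tendsto_powr_complex_0)
  next
    case False
    have "1 - z \<notin> \<real>\<^sub>\<le>\<^sub>0"
    proof
      assume "1 - z \<in> \<real>\<^sub>\<le>\<^sub>0"
      then have z: "1 \<le> Re z" "Im z = 0" by (auto simp: complex_nonpos_Reals_iff)
      moreover have "Re z \<le> 1" using complex_Re_le_cmod[of z] assms(3) by linarith
      ultimately show False using False by (simp add: complex_eq_iff)
    qed
    then show ?thesis by (intro tendsto_powr_complex lim tendsto_const)
  qed
  moreover have "pgf (measure_pmf p) (r k * z) = 1 - (1 - r k * z) powr of_real \<gamma>" for k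
    unfolding p_def using rz[of k] assms sibuya_sums_complex[of "r k * z" \<gamma>]
    by (intro pgf_eqI) (auto simp: pmf_sibuya)
  ultimately show "(\<lambda>k. pgf (measure_pmf p) (r k * z)) \<longlonglongrightarrow> 1 - (1 - z) powr of_real \<gamma>"
    by (simp add: tendsto_diff)
qed

text \<open>
  \<^const>\<open>is_PDS\<close> is satisfiable: a compound Poisson sum whose jumps are Sibuya many
  geometric variables.
\<close>

lemma PDS_exists:
  assumes "0 < \<gamma>" "\<gamma> \<le> 1" "l > 0" "0 \<le> \<kappa>" "\<kappa> < 1"
  shows "\<exists>p. is_PDS \<gamma> l \<kappa> (measure_pmf p)"
proof -
  define G where "G = map_pmf ((+) 1) (geometric_pmf (1 - \<kappa>))"
  define J where "J = bind_pmf (embed_pmf (sibuya \<gamma>)) (iid_sum G)"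
  define p where "p = bind_pmf (poisson_pmf l) (iid_sum J)"
  have "pgf (measure_pmf p) z =
      exp (- of_real l * ((1 - z) / (1 - of_real \<kappa> * z)) powr of_real \<gamma>)"
    if z: "norm z \<le> 1" for z
  proof -
    have J: "pgf (measure_pmf J) z = 1 - ((1 - z) / (1 - of_real \<kappa> * z)) powr of_real \<gamma>"
      using pgf_sibuya[OF assms(1,2) norm_pgf_le[OF z, of G]]
      unfolding J_def pgf_compound[OF z] G_def pgf_geometric[OF z assms(4,5)] by simp
    show ?thesis
      using pgf_poisson[OF norm_pgf_le[OF z, of J] assms(3)]
      unfolding p_def pgf_compound[OF z] by (simp add: J)
  qed
  then have "is_PDS \<gamma> l \<kappa> (measure_pmf p)"
    by (simp add: is_PDS_def measure_pmf.prob_space_axioms)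
  then show ?thesis by blast
qed

end

theory Submission
  imports Defs
begin

text \<open>
  The characteristic function of \<open>a X\<close> at \<open>t\<close> is the generating function of \<open>X\<close> at
  \<open>e\<^bsup>i a t\<^esup>\<close>, which yields the formula for \<open>f\<close> (\<open>char_scaled_nat\<close>). With
  \<open>w = (1 - e\<^bsup>i a t\<^esup>) / (1 - \<kappa> e\<^bsup>i a t\<^esup>)\<close>, the exponent is \<open>- b a\<^bsup>-\<gamma>\<^esup> w\<^sup>\<gamma>\<close>. Since \<open>a\<close> is a positive
  real, it can be moved under the principal power, so the exponent equals \<open>- b (w / a)\<^sup>\<gamma>\<close>
  (\<open>powr_of_real_mult_left\<close>). Now \<open>w / a\<close> is essentially the difference quotient of the
  exponential and tends to \<open>- i t / (1 - \<kappa>)\<close> as \<open>a\<close> decreases to \<open>0\<close>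
  (\<open>tendsto_scaled_pgf_base\<close>). For \<open>t \<noteq> 0\<close> that point lies on the imaginary axis away from
  the origin, hence off the branch cut, and the principal power is continuous there; the
  argument \<open>- sgn t \<pi> / 2\<close> of the limit point produces the factor
  \<open>cos (\<pi> \<gamma> / 2) - i sgn t sin (\<pi> \<gamma> / 2)\<close> (\<open>powr_neg_i_times_of_real\<close>). For \<open>t = 0\<close> both
  sides are \<open>1\<close>.
\<close>

lemma char_scaled_nat:
  assumes [measurable]: "X \<in> measurable M (count_space UNIV)"
  shows "char (distr M borel (\<lambda>\<omega>. a * real (X \<omega>))) t =
    pgf (distr M (count_space UNIV) X) (iexp (a * t))"
proof -
  have "char (distr M borel (\<lambda>\<omega>. a * real (X \<omega>))) t = (CLINT \<omega>|M. iexp (t * (a * real (X \<omega>))))"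
    unfolding char_def by (rule integral_distr) auto
  also have "\<dots> = (CLINT \<omega>|M. iexp (a * t) ^ X \<omega>)"
    by (simp add: exp_of_nat_mult [symmetric] mult_ac)
  also have "\<dots> = pgf (distr M (count_space UNIV) X) (iexp (a * t))"
    unfolding pgf_def by (rule integral_distr [symmetric]) auto
  finally show ?thesis .
qed

text \<open>
  Principal powers are not multiplicative in general, but scaling the base by a positive real
  leaves its argument, and hence the branch of the logarithm, unchanged.
\<close>

lemma powr_of_real_mult_left:
  assumes "0 < r"
  shows "(of_real r * z :: complex) powr of_real c = of_real (r powr c) * z powr of_real c"
proof (cases "z = 0")
  case False
  then show ?thesis
    using assms
    by (simp add: powr_def Ln_times_of_real Ln_of_real distrib_left exp_add exp_of_real [symmetric])
qed simp

lemma powr_neg_i_times_of_real: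
  assumes "t \<noteq> 0" "0 < d"
  shows "(- \<i> * of_real t / of_real d) powr of_real \<gamma> =
    of_real (\<bar>t\<bar> powr \<gamma> / d powr \<gamma>) *
      (of_real (cos (pi * \<gamma> / 2)) - \<i> * of_real (sgn t * sin (pi * \<gamma> / 2)))"
proof -
  \<comment> \<open>polar form: a positive modulus times the unit \<open>\<mp> i\<close>\<close>
  have base: "- \<i> * of_real t / of_real d = of_real (\<bar>t\<bar> / d) * (- of_real (sgn t) * \<i>)"
    by (simp add: sgn_if)
  have "(- of_real (sgn t) * \<i>) powr of_real \<gamma> = cis (- (sgn t * (pi * \<gamma> / 2)))"
    using assms(1) by (auto simp: powr_def sgn_if cis_conv_exp mult_ac)
  also have "\<dots> = of_real (cos (pi * \<gamma> / 2)) - \<i> * of_real (sgn t * sin (pi * \<gamma> / 2))"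
    using assms(1) by (auto simp: sgn_if complex_eq_iff)
  finally show ?thesis
    unfolding base using assms
    by (subst powr_of_real_mult_left) (auto simp: powr_divide)
qed

text \<open>
  The numerator divided by \<open>a\<close> is minus the difference quotient at \<open>0\<close> of the function
  \<open>z \<mapsto> e\<^bsup>i z t\<^esup>\<close>, whose derivative there is \<open>i t\<close>, while the denominator tends to \<open>1 - \<kappa>\<close>.
\<close>

lemma tendsto_scaled_pgf_base:
  assumes "\<kappa> \<noteq> 1"
  shows "((\<lambda>a. (1 - iexp (a * t)) / (1 - of_real \<kappa> * iexp (a * t)) / of_real a) \<longlongrightarrow>
    - \<i> * of_real t / of_real (1 - \<kappa>)) (at_right 0)"
proof -
  have deriv: "((\<lambda>z. exp (\<i> * (z * of_real t))) has_field_derivative \<i> * of_real t) (at 0)"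
    by (auto intro!: derivative_eq_intros)
  have "((\<lambda>z. (exp (\<i> * (z * of_real t)) - 1) / z) \<longlongrightarrow> \<i> * of_real t) (at 0)"
    using deriv by (simp add: has_field_derivative_iff)
  moreover have "filterlim complex_of_real (at 0) (at_right 0)"
    unfolding filterlim_at
    by (auto intro!: tendsto_eq_intros simp: eventually_at_filter)
  ultimately have "((\<lambda>a. (exp (\<i> * (of_real a * of_real t)) - 1) / of_real a) \<longlongrightarrow> \<i> * of_real t)
      (at_right 0)"
    by (rule filterlim_compose)
  then have quot: "((\<lambda>a. (iexp (a * t) - 1) / of_real a) \<longlongrightarrow> \<i> * of_real t) (at_right 0)"
    by simp
  have den: "((\<lambda>a. 1 - of_real \<kappa> * iexp (a * t)) \<longlongrightarrow> of_real (1 - \<kappa>)) (at_right 0)"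
    by (auto intro!: tendsto_eq_intros)
  have "((\<lambda>a. - ((iexp (a * t) - 1) / of_real a) / (1 - of_real \<kappa> * iexp (a * t))) \<longlongrightarrow>
      - (\<i> * of_real t) / of_real (1 - \<kappa>)) (at_right 0)"
    using assms by (intro tendsto_divide tendsto_minus quot den) (simp del: of_real_diff)
  moreover have "- ((e - 1) / a) / d = (1 - e) / d / a" for a d e :: complex
    by (simp add: divide_inverse algebra_simps)
  ultimately show ?thesis
    by (simp only: mult_minus_left)
qed

theorem theorem3p11:
  fixes \<gamma> \<kappa> b :: real
    and M :: "real \<Rightarrow> 'a measure"
    and X :: "real \<Rightarrow> 'a \<Rightarrow> nat"
  assumes "0 < \<gamma>" "\<gamma> \<le> 1" "0 \<le> \<kappa>" "\<kappa> < 1" "0 < b"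
    and "\<And>a. 0 < a \<Longrightarrow> prob_space (M a)"
    and "\<And>a. 0 < a \<Longrightarrow> X a \<in> measurable (M a) (count_space UNIV)"
    and "\<And>a. 0 < a \<Longrightarrow> is_PDS \<gamma> (b / a powr \<gamma>) \<kappa> (distr (M a) (count_space UNIV) (X a))"
  defines "f \<equiv> \<lambda>a t. char (distr (M a) borel (\<lambda>\<omega>. a * real (X a \<omega>))) t"
  shows "(\<forall>a>0. \<forall>t. f a t =
            exp (- of_real (b / a powr \<gamma>) *
              ((1 - iexp (a * t)) / (1 - of_real \<kappa> * iexp (a * t))) powr of_real \<gamma>)) \<and>
         (\<forall>t. ((\<lambda>a. f a t) \<longlongrightarrow> limit_cf \<gamma> \<kappa> b t) (at_right 0))"
proof -
  have formula: "f a t = exp (- of_real (b / a powr \<gamma>) *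
      ((1 - iexp (a * t)) / (1 - of_real \<kappa> * iexp (a * t))) powr of_real \<gamma>)"
    if "0 < a" for a t
    using assms(7,8)[OF that] by (simp add: f_def char_scaled_nat is_PDS_def)
  have "((\<lambda>a. f a t) \<longlongrightarrow> limit_cf \<gamma> \<kappa> b t) (at_right 0)" for t
  proof (rule Lim_transform_eventually)
    let ?w = "\<lambda>a. (1 - iexp (a * t)) / (1 - of_real \<kappa> * iexp (a * t))"
    show "\<forall>\<^sub>F a in at_right 0. exp (- of_real b * (?w a / of_real a) powr of_real \<gamma>) = f a t"
      using eventually_at_right_less
    proof eventually_elim
      case (elim a)
      have "(?w a / of_real a) powr of_real \<gamma> = of_real (inverse a powr \<gamma>) * ?w a powr of_real \<gamma>"
        using powr_of_real_mult_left[of "inverse a" "?w a" \<gamma>] elim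
        by (simp add: field_simps)
      moreover have "inverse a powr \<gamma> = inverse (a powr \<gamma>)"
        using elim by (simp add: powr_minus powr_def ln_inverse exp_minus [symmetric])
      ultimately show ?case
        using elim by (simp only: formula) (simp add: divide_inverse mult_ac)
    qed
    show "((\<lambda>a. exp (- of_real b * (?w a / of_real a) powr of_real \<gamma>)) \<longlongrightarrow> limit_cf \<gamma> \<kappa> b t)
        (at_right 0)"
    proof (cases "t = 0")
      case True
      \<comment> \<open>both exponents vanish, by the convention \<open>0 powr \<gamma> = 0\<close>\<close>
      then show ?thesis by (simp add: limit_cf_def)
    next
      case False
      let ?p = "- \<i> * of_real t / of_real (1 - \<kappa>) :: complex"
      \<comment> \<open>the limit point is off the branch cut because it is not real\<close>
      have "Im ?p \<noteq> 0"
        using False \<open>\<kappa> < 1\<close> unfolding Im_divide_of_real by simp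
      then have "?p \<notin> \<real>\<^sub>\<le>\<^sub>0"
        using complex_nonpos_Reals_iff by blast
      then have "((\<lambda>a. exp (- of_real b * (?w a / of_real a) powr of_real \<gamma>)) \<longlongrightarrow>
          exp (- of_real b * ?p powr of_real \<gamma>)) (at_right 0)"
        using \<open>\<kappa> < 1\<close>
        by (intro tendsto_intros tendsto_powr_complex tendsto_scaled_pgf_base) auto
      moreover have "exp (- of_real b * ?p powr of_real \<gamma>) = limit_cf \<gamma> \<kappa> b t"
        using False \<open>\<kappa> < 1\<close> unfolding limit_cf_def
        by (subst powr_neg_i_times_of_real) (simp_all add: mult_ac)
      ultimately show ?thesis by simp
    qed
  qed
  with formula show ?thesis by blast
qed

end
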